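(* Let $(X,Y,D)$ be random variables with $X\in\mathcal{X}$, $Y\in\mathcal{Y}$ (a finite set) and $D\in\{1,\dots,K\}$, with $P(D=k)>0$ for every $k$. Let $\{g_\phi:\mathcal{X}\to\mathbb{R}^d\}_{\phi}$ be a family of measurable feature extractors and write $Z=g_\phi(X)$. Fix $\lambda>0$. For a set of domains $\mathcal{K}\subseteq\{1,\dots,K\}$ let $\mathcal{P}(\mathcal{K})=\{(i,j)\in\mathcal{K}\times\mathcal{K}: i<j\}$ and $$\mathcal{J}_{\mathcal{K}}(\phi)=I(Z;Y)-\lambda\sum_{(i,j)\in\mathcal{P}(\mathcal{K})} I\left(Z;D\,\middle|\,Y,\,D\in\{i,j\}\right).$$ Suppose that for every domain set $\mathcal{K}\subseteq\{1,\dots,K\}$ there exists a maximizer $\phi^*_{\mathcal{K}}$ of $\mathcal{J}_{\mathcal{K}}$ over $\phi$ which, with $Z^*_{\mathcal{K}}=g_{\phi^*_{\mathcal{K}}}(X)$, satisfies exact pairwise conditional invariance: $$I\left(Z^*_{\mathcal{K}};D\,\middle|\,Y,\,D\in\{i,j\}\right)=0\qquad\text{for all }(i,j)\in\mathcal{P}(\mathcal{K}).$$ Then, for all domain sets $\mathcal{K}\subseteq\mathcal{K}'\subseteq\{1,\dots,K\}$, $$I(Z^*_{\mathcal{K}'};Y)\le I(Z^*_{\mathcal{K}};Y).$$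
   Context: $X$ is the input, $Y$ the label, $D$ the domain index. The joint distribution of $(X,Y,D)$ is fixed and does not depend on $\mathcal{K}$ or $\phi$; in particular $I(Z;Y)$ is the mutual information under this fixed distribution. $I(Z;D\mid Y, D\in\{i,j\})$ denotes the conditional mutual information of $Z$ and $D$ given $Y$, computed under the joint distribution conditioned on the event $\{D\in\{i,j\}\}$. *)

theory Defs
  imports "HOL-Probability.Probability"
begin

text \<open>
  \<open>M\<close> carries the random variables; \<open>b > 1\<close> is the base of the logarithm in which all
  information quantities are measured; \<open>YY\<close> is the finite label set and \<open>{1..K}\<close> the set of
  domain indices, both with the discrete sigma-algebra. The library's Bochner-integral based
  mutual information returns 0 when the information density is not integrable and is only meaningful
  when the joint law is absolutely continuous with respect to the product of the marginals.
  Neither pitfall arises below: \<open>Y\<close> and \<open>(D, Y)\<close> take finitely many values, so the joint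
  law is absolutely continuous and all mutual informations are finite. For the same reason the
  difference by which the library defines conditional mutual information,
  \<open>I(Z; D | Y) = I(Z; (D, Y)) - I(Z; Y)\<close>, is never of the form \<open>\<infinity> - \<infinity>\<close>.
\<close>

definition domain_pairs :: "nat set \<Rightarrow> (nat \<times> nat) set" where
  "domain_pairs S = {(i, j). i \<in> S \<and> j \<in> S \<and> i < j}"

definition info :: "real \<Rightarrow> 'w measure \<Rightarrow> 'y set \<Rightarrow> ('w \<Rightarrow> 'z::topological_space) \<Rightarrow> ('w \<Rightarrow> 'y) \<Rightarrow> real" where
  "info b M YY Z Y = prob_space.mutual_information M b borel (count_space YY) Z Y"

text \<open>\<open>I(Z; D | Y, D \<in> {i, j})\<close>: conditional mutual information under the probability measure \<open>M\<close>
  conditioned on the event \<open>{D \<in> {i, j}}\<close>.\<close>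

definition pair_info :: "real \<Rightarrow> 'w measure \<Rightarrow> 'y set \<Rightarrow> nat \<Rightarrow>
    ('w \<Rightarrow> 'z::topological_space) \<Rightarrow> ('w \<Rightarrow> nat) \<Rightarrow> ('w \<Rightarrow> 'y) \<Rightarrow> nat \<Rightarrow> nat \<Rightarrow> real" where
  "pair_info b M YY K Z D Y i j =
     prob_space.conditional_mutual_information
       (uniform_measure M {\<omega> \<in> space M. D \<omega> \<in> {i, j}}) b
       borel (count_space {1..K}) (count_space YY) Z D Y"

definition objective :: "real \<Rightarrow> 'w measure \<Rightarrow> 'y set \<Rightarrow> nat \<Rightarrow> real \<Rightarrow>
    ('w \<Rightarrow> 'x) \<Rightarrow> ('w \<Rightarrow> nat) \<Rightarrow> ('w \<Rightarrow> 'y) \<Rightarrow> ('p \<Rightarrow> 'x \<Rightarrow> 'z::topological_space) \<Rightarrow>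
    nat set \<Rightarrow> 'p \<Rightarrow> real" where
  "objective b M YY K lam X D Y g S \<phi> =
     info b M YY (g \<phi> \<circ> X) Y
       - lam * (\<Sum>(i, j)\<in>domain_pairs S. pair_info b M YY K (g \<phi> \<circ> X) D Y i j)"

end

theory Submission
  imports Defs
begin

text \<open>The maximizer for the larger set \<open>S'\<close> competes in the problem for the
  smaller set \<open>S\<close>. Every pair from \<open>S\<close> is a pair from \<open>S'\<close>,
  so its invariance makes the penalty of the \<open>S\<close>-objective vanish at it; the penalty
  also vanishes at the maximizer for \<open>S\<close>. At both points the \<open>S\<close>-objective
  is therefore just the information about \<open>Y\<close> (\<open>objective_eq_info\<close>), and
  optimality over \<open>S\<close> compares the two values.\<close>

lemma objective_eq_info:
  assumes "\<And>i j. (i, j) \<in> domain_pairs S \<Longrightarrow> pair_info b M YY K (g \<phi> \<circ> X) D Y i j = 0"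
  shows "objective b M YY K lam X D Y g S \<phi> = info b M YY (g \<phi> \<circ> X) Y"
proof -
  have "(\<Sum>(i, j)\<in>domain_pairs S. pair_info b M YY K (g \<phi> \<circ> X) D Y i j) = 0"
    using assms by (intro sum.neutral) auto
  then show ?thesis
    by (simp add: objective_def)
qed

lemma domain_pairs_mono: "S \<subseteq> S' \<Longrightarrow> domain_pairs S \<subseteq> domain_pairs S'"
  by (auto simp: domain_pairs_def)

theorem theorem3p4:
  fixes M :: "'w measure" and MX :: "'x measure" and YY :: "'y set" and K :: nat
    and X :: "'w \<Rightarrow> 'x" and Y :: "'w \<Rightarrow> 'y" and D :: "'w \<Rightarrow> nat"
    and \<Phi> :: "'p set" and g :: "'p \<Rightarrow> 'x \<Rightarrow> real ^ 'd::finite"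
    and lam b :: real and \<phi>star :: "nat set \<Rightarrow> 'p"
  assumes "prob_space M" and "b > 1"
    and "X \<in> measurable M MX"
    and "finite YY" and "Y \<in> measurable M (count_space YY)"
    and "D \<in> measurable M (count_space {1..K})"
    and "\<And>k. k \<in> {1..K} \<Longrightarrow> measure M {\<omega> \<in> space M. D \<omega> = k} > 0"
    and "\<And>\<phi>. \<phi> \<in> \<Phi> \<Longrightarrow> g \<phi> \<in> borel_measurable MX"
    and "lam > 0"
    and "\<And>S. S \<subseteq> {1..K} \<Longrightarrow>
           is_arg_max (objective b M YY K lam X D Y g S) (\<lambda>\<phi>. \<phi> \<in> \<Phi>) (\<phi>star S)"
    and "\<And>S i j. S \<subseteq> {1..K} \<Longrightarrow> (i, j) \<in> domain_pairs S \<Longrightarrow>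
           pair_info b M YY K (g (\<phi>star S) \<circ> X) D Y i j = 0"
  shows "\<And>S S'. S \<subseteq> S' \<Longrightarrow> S' \<subseteq> {1..K} \<Longrightarrow>
           info b M YY (g (\<phi>star S') \<circ> X) Y \<le> info b M YY (g (\<phi>star S) \<circ> X) Y"
proof -
  fix S S' :: "nat set"
  assume SS': "S \<subseteq> S'" and S': "S' \<subseteq> {1..K}"
  then have S: "S \<subseteq> {1..K}" by simp
  \<comment> \<open>The comparison uses the objective of the smaller set: under that of
    \<open>S'\<close>, the penalty at \<open>\<phi>star S\<close> need not vanish, since pairs
    outside \<open>S\<close> are not controlled there.\<close>
  let ?J = "objective b M YY K lam X D Y g S"
  have inv: "pair_info b M YY K (g (\<phi>star S') \<circ> X) D Y i j = 0"
    if "(i, j) \<in> domain_pairs S" for i j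
    using assms(11)[OF S'] domain_pairs_mono[OF SS'] that by blast
  have "\<phi>star S' \<in> \<Phi>"
    using assms(10)[OF S'] by (simp add: is_arg_max_def)
  \<comment> \<open>\<open>is_arg_max\<close> only says that no feasible point is strictly better;
    linearity of the order on the reals turns this into an inequality.\<close>
  then have "?J (\<phi>star S') \<le> ?J (\<phi>star S)"
    using assms(10)[OF S] by (auto simp: is_arg_max_linorder)
  moreover have "?J (\<phi>star S') = info b M YY (g (\<phi>star S') \<circ> X) Y"
    using inv by (rule objective_eq_info)
  moreover have "?J (\<phi>star S) = info b M YY (g (\<phi>star S) \<circ> X) Y"
    using assms(11)[OF S] by (rule objective_eq_info)
  ultimately show "info b M YY (g (\<phi>star S') \<circ> X) Y \<le> info b M YY (g (\<phi>star S) \<circ> X) Y"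
    by simp
qed

end
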